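(* Let $D=\{1,\dots,d\}$ with $d\ge2$, let $(V_\alpha,\|\cdot\|_\alpha)$ be a Banach space for each $\alpha\in D$, let $\mathbf V={}_a\bigotimes_{\alpha\in D}V_\alpha$ be the algebraic tensor product, and let $\|\cdot\|$ be a norm on $\mathbf V$ such that $\|\cdot\|_{\vee(V_1,\dots,V_d)}\lesssim\|\cdot\|$ on $\mathbf V$ and such that the completion $\mathbf V_{\|\cdot\|}$ of $(\mathbf V,\|\cdot\|)$ is a reflexive and strictly convex Banach space. Let $A$ be a densely defined linear operator in $\mathbf V_{\|\cdot\|}$, with domain $\mathcal D(A)$, generating a flow on $\mathcal D(A)$. Let $I=(0,T)$ with $T>0$, and let $\mathbf v_0=\bigotimes_{\alpha\in D}v_0^{(\alpha)}\in\mathfrak M_{(1,\dots,1)}(\mathbf V)$. Then the solution $\mathbf v_r(t)=\bigotimes_{\alpha\in D}v_\alpha(t)\in\mathfrak M_{(1,\dots,1)}(\mathbf V)$, with $(v_1(t),\dots,v_d(t))\in\prod_{\alpha\in D}V_\alpha$, of $$\dot{\mathbf v}_r(t)=\mathcal P_{\mathbf v_r(t)}(A\mathbf v_r(t))\ \text{ for }t\in I,\qquad \mathbf v_r(0)=\mathbf v_0,$$ satisfies $$\Big\langle\dot w_\alpha\otimes\Big(\bigotimes_{\beta\in D,\,\beta\ne\alpha}v_\beta(t)\Big),\,J(\dot{\mathbf v}_r(t)-A\mathbf v_r(t))\Big\rangle=0\qquad\text{for all }\dot w_\alpha\in V_\alpha,\ \alpha\in D.$$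
   Context: $\mathfrak M_{(1,\dots,1)}(\mathbf V)$ (the Hartree manifold) is the set of nonzero elementary tensors $\lambda\bigotimes_{\alpha\in D}v_\alpha$. The result concerns the case in which the scalar factor in $\mathbf v_r(t)=\lambda(t)\bigotimes_{\alpha\in D} v_\alpha(t)$ is $\lambda(t)=1$ for all $t$. Injective norm: $\|\mathbf v\|_{\vee(V_1,\dots,V_d)}=\sup\Big\{\frac{|(\varphi_1\otimes\cdots\otimes\varphi_d)(\mathbf v)|}{\prod_{\alpha\in D}\|\varphi_\alpha\|_\alpha^*}:0\ne\varphi_\alpha\in V_\alpha^*,\ \alpha\in D\Big\}$, where $\|\cdot\|_\alpha^*$ is the dual norm on $V_\alpha^*$. For two norms, $\|\cdot\|_1\lesssim\|\cdot\|_2$ means $\|\cdot\|_1\le C\|\cdot\|_2$ for some constant $C$. Tangent space: for $\mathbf v=\lambda\bigotimes_\alpha v_\alpha\in\mathfrak M_{(1,\dots,1)}(\mathbf V)$ and closed subspaces $W_\alpha$ with $V_\alpha=\mathrm{span}\{v_\alpha\}\oplus W_\alpha$, the image in $\mathbf V_{\|\cdot\|}$ of the tangent space of the Hartree manifold at $\mathbf v$ is $$\mathbf Z^{(D)}(\mathbf v)=\mathrm{span}\Big\{\bigotimes_{\alpha\in D}v_\alpha\Big\}\oplus\bigoplus_{\alpha\in D}\Big(W_\alpha\otimes_a\mathrm{span}\Big\{\bigotimes_{\beta\ne\alpha}v_\beta\Big\}\Big).$$ The metric projection $\mathcal P_{\mathbf v}:\mathbf V_{\|\cdot\|}\to\mathbf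 Z^{(D)}(\mathbf v)$ sends $\mathbf x$ to the unique $\dot{\mathbf v}\in\mathbf Z^{(D)}(\mathbf v)$ minimising $\|\dot{\mathbf v}-\mathbf x\|$. Duality: $\langle x,f\rangle=f(x)$ for $x\in X$, $f\in X^*$; the normalised duality mapping of a Banach space $X$ is $J:X\to2^{X^*}$, $J(x)=\{f\in X^*:\langle x,f\rangle=\|x\|^2=(\|f\|^* )^2\}$; it is single-valued if $X$ is smooth. Here $X=\mathbf V_{\|\cdot\|}$. Flow: $A$ generates a flow if there are bijections $\boldsymbol\varphi_t:\mathcal D(A)\to\mathcal D(A)$ with $\boldsymbol\varphi_0=\mathrm{id}$, $\boldsymbol\varphi_{t+s}=\boldsymbol\varphi_t\circ\boldsymbol\varphi_s$, and such that for $\mathbf u_0\in\mathcal D(A)$ the curve $\mathbf u(t)=\boldsymbol\varphi_t(\mathbf u_0)$ is differentiable in $\mathbf V_{\|\cdot\|}$ with $\dot{\mathbf u}=A\mathbf u$, $\mathbf u(0)=\mathbf u_0$.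
   Formalization: Without smoothness J is set-valued, so the pairing with J(...) is undefined, and it fails if read for every element of J(...); the conclusion is stated as: for each t, one f in J(...) vanishes on all these tensors, for all α and ẇ_α. If J is single-valued, this is the claim as written. *)

theory Defs
  imports "HOL-Analysis.Analysis"
begin

text \<open>
  The Banach spaces $V_\alpha$ are given by carriers \<open>V \<alpha>\<close>, subspaces of one ambient real vector
  space, each with its own norm \<open>nV \<alpha>\<close>.  The ambient space has no norm, and every family of real
  vector spaces embeds in a common one (their direct sum), so this is no restriction; it only serves
  to give the different $V_\alpha$ a common type.  Tuples $(v_\alpha)_{\alpha\in D}$ are the elements of
  \<open>PiE D V\<close>.
\<close>

definition linear_on :: "'a::real_vector set \<Rightarrow> ('a \<Rightarrow> 'b::real_vector) \<Rightarrow> bool" where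
  "linear_on S f \<longleftrightarrow>
     subspace S \<and>
     (\<forall>x\<in>S. \<forall>y\<in>S. f (x + y) = f x + f y) \<and>
     (\<forall>c. \<forall>x\<in>S. f (c *\<^sub>R x) = c *\<^sub>R f x)"

definition norm_on :: "'a::real_vector set \<Rightarrow> ('a \<Rightarrow> real) \<Rightarrow> bool" where
  "norm_on S n \<longleftrightarrow>
     (\<forall>x\<in>S. 0 \<le> n x \<and> (n x = 0 \<longleftrightarrow> x = 0)) \<and>
     (\<forall>x\<in>S. \<forall>y\<in>S. n (x + y) \<le> n x + n y) \<and>
     (\<forall>c. \<forall>x\<in>S. n (c *\<^sub>R x) = \<bar>c\<bar> * n x)"

definition banach_on :: "'a::real_vector set \<Rightarrow> ('a \<Rightarrow> real) \<Rightarrow> bool" where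
  "banach_on S n \<longleftrightarrow>
     subspace S \<and> norm_on S n \<and>
     (\<forall>s :: nat \<Rightarrow> 'a.
        range s \<subseteq> S \<and> (\<forall>e>0. \<exists>N. \<forall>i\<ge>N. \<forall>j\<ge>N. n (s i - s j) < e) \<longrightarrow>
        (\<exists>x\<in>S. (\<lambda>k. n (s k - x)) \<longlonglongrightarrow> 0))"

definition closed_in_norm :: "'a::real_vector set \<Rightarrow> ('a \<Rightarrow> real) \<Rightarrow> 'a set \<Rightarrow> bool" where
  "closed_in_norm S n W \<longleftrightarrow>
     W \<subseteq> S \<and>
     (\<forall>(s :: nat \<Rightarrow> 'a) x.
        range s \<subseteq> W \<and> x \<in> S \<and> (\<lambda>k. n (s k - x)) \<longlonglongrightarrow> 0 \<longrightarrow> x \<in> W)"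

definition closed_complement :: "'a::real_vector set \<Rightarrow> ('a \<Rightarrow> real) \<Rightarrow> 'a set \<Rightarrow> 'a set \<Rightarrow> bool" where
  "closed_complement S n U W \<longleftrightarrow>
     subspace W \<and> closed_in_norm S n W \<and>
     U \<inter> W = {0} \<and> S = {u + w | u w. u \<in> U \<and> w \<in> W}"

definition dual_on :: "'a::real_vector set \<Rightarrow> ('a \<Rightarrow> real) \<Rightarrow> ('a \<Rightarrow> real) set" where
  "dual_on S n = {\<phi>. linear_on S \<phi> \<and> (\<exists>C. \<forall>x\<in>S. \<bar>\<phi> x\<bar> \<le> C * n x)}"

definition dual_norm_on :: "'a::real_vector set \<Rightarrow> ('a \<Rightarrow> real) \<Rightarrow> ('a \<Rightarrow> real) \<Rightarrow> real" where
  "dual_norm_on S n \<phi> = Sup {\<bar>\<phi> x\<bar> / n x | x. x \<in> S \<and> x \<noteq> 0}"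


text \<open>
  The algebraic tensor product is the free vector space on $\prod_{\alpha\in D} V_\alpha$ modulo the
  subspace generated by the multilinearity relations.  The free vector space consists of the finitely
  supported coefficient functions on \<open>PiE D V\<close>; \<open>free_lift f\<close> is the linear extension of \<open>f\<close> to it.
\<close>

definition formal_sums :: "'i set \<Rightarrow> ('i \<Rightarrow> 'a set) \<Rightarrow> (('i \<Rightarrow> 'a) \<Rightarrow> real) set" where
  "formal_sums D V = {c. finite {v. c v \<noteq> 0} \<and> {v. c v \<noteq> 0} \<subseteq> PiE D V}"

definition generator :: "('i \<Rightarrow> 'a) \<Rightarrow> ('i \<Rightarrow> 'a) \<Rightarrow> real" where
  "generator v = (\<lambda>u. if u = v then 1 else 0)"

definition free_lift :: "(('i \<Rightarrow> 'a) \<Rightarrow> 'b::real_vector) \<Rightarrow> (('i \<Rightarrow> 'a) \<Rightarrow> real) \<Rightarrow> 'b" where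
  "free_lift f c = (\<Sum>v | c v \<noteq> 0. c v *\<^sub>R f v)"

inductive_set multilinear_relations ::
    "'i set \<Rightarrow> ('i \<Rightarrow> 'a::real_vector set) \<Rightarrow> (('i \<Rightarrow> 'a) \<Rightarrow> real) set"
  for D :: "'i set" and V :: "'i \<Rightarrow> 'a set" where
  additive: "\<lbrakk>v \<in> PiE D V; \<alpha> \<in> D; x \<in> V \<alpha>; y \<in> V \<alpha>\<rbrakk> \<Longrightarrow>
    (\<lambda>u. generator (v(\<alpha> := x + y)) u - generator (v(\<alpha> := x)) u - generator (v(\<alpha> := y)) u)
      \<in> multilinear_relations D V"
| homogeneous: "\<lbrakk>v \<in> PiE D V; \<alpha> \<in> D; x \<in> V \<alpha>\<rbrakk> \<Longrightarrow>
    (\<lambda>u. generator (v(\<alpha> := a *\<^sub>R x)) u - a * generator (v(\<alpha> := x)) u)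
      \<in> multilinear_relations D V"
| zero: "(\<lambda>u. 0) \<in> multilinear_relations D V"
| combination: "\<lbrakk>p \<in> multilinear_relations D V; q \<in> multilinear_relations D V\<rbrakk> \<Longrightarrow>
    (\<lambda>u. a * p u + b * q u) \<in> multilinear_relations D V"

text \<open>
  \<open>tens v\<close> is the elementary tensor $\bigotimes_{\alpha\in D} v_\alpha$.  By the kernel condition, the
  span of the elementary tensors is a copy of the algebraic tensor product $\mathbf V$.  It is viewed
  as a subspace of its completion: if \<open>'x\<close> is a Banach space in which \<open>algebraic_tensors D V tens\<close> is
  dense, then \<open>norm\<close> restricted to that subspace is a norm on $\mathbf V$ and \<open>'x\<close> is the completion
  with respect to it; every norm on $\mathbf V$ arises in this way.
\<close>

definition is_algebraic_tensor_product ::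
    "'i set \<Rightarrow> ('i \<Rightarrow> 'a::real_vector set) \<Rightarrow> (('i \<Rightarrow> 'a) \<Rightarrow> 'x::real_vector) \<Rightarrow> bool" where
  "is_algebraic_tensor_product D V tens \<longleftrightarrow>
     {c \<in> formal_sums D V. free_lift tens c = 0} = multilinear_relations D V"

definition algebraic_tensors ::
    "'i set \<Rightarrow> ('i \<Rightarrow> 'a set) \<Rightarrow> (('i \<Rightarrow> 'a) \<Rightarrow> 'x::real_vector) \<Rightarrow> 'x set" where
  "algebraic_tensors D V tens = span (tens ` PiE D V)"

definition is_tensor_completion ::
    "'i set \<Rightarrow> ('i \<Rightarrow> 'a::real_vector set) \<Rightarrow> (('i \<Rightarrow> 'a) \<Rightarrow> 'x::banach) \<Rightarrow> bool" where
  "is_tensor_completion D V tens \<longleftrightarrow>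
     is_algebraic_tensor_product D V tens \<and> closure (algebraic_tensors D V tens) = UNIV"

definition hartree_manifold ::
    "'i set \<Rightarrow> ('i \<Rightarrow> 'a set) \<Rightarrow> (('i \<Rightarrow> 'a) \<Rightarrow> 'x::real_vector) \<Rightarrow> 'x set" where
  "hartree_manifold D V tens = {c *\<^sub>R tens v | c v. v \<in> PiE D V} - {0}"

text \<open>
  The value of $\varphi_1\otimes\cdots\otimes\varphi_d$ at an algebraic tensor, computed from any
  representation as a linear combination of elementary tensors; the kernel condition above makes it
  independent of the representation.
\<close>

definition tensor_functional ::
    "'i set \<Rightarrow> ('i \<Rightarrow> 'a set) \<Rightarrow> (('i \<Rightarrow> 'a) \<Rightarrow> 'x::real_vector) \<Rightarrow> ('i \<Rightarrow> 'a \<Rightarrow> real) \<Rightarrow> 'x \<Rightarrow> real" where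
  "tensor_functional D V tens \<phi> x =
     (THE s. \<exists>c \<in> formal_sums D V.
        x = free_lift tens c \<and> s = free_lift (\<lambda>v. \<Prod>\<alpha>\<in>D. \<phi> \<alpha> (v \<alpha>)) c)"

definition injective_norm ::
    "'i set \<Rightarrow> ('i \<Rightarrow> 'a::real_vector set) \<Rightarrow> ('i \<Rightarrow> 'a \<Rightarrow> real) \<Rightarrow>
     (('i \<Rightarrow> 'a) \<Rightarrow> 'x::real_vector) \<Rightarrow> 'x \<Rightarrow> real" where
  "injective_norm D V nV tens x =
     Sup {\<bar>tensor_functional D V tens \<phi> x\<bar> / (\<Prod>\<alpha>\<in>D. dual_norm_on (V \<alpha>) (nV \<alpha>) (\<phi> \<alpha>)) | \<phi>.
            \<forall>\<alpha>\<in>D. \<phi> \<alpha> \<in> dual_on (V \<alpha>) (nV \<alpha>) \<and> (\<exists>y\<in>V \<alpha>. \<phi> \<alpha> y \<noteq> 0)}"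


definition reflexive_space :: "'x::real_normed_vector itself \<Rightarrow> bool" where
  "reflexive_space _ \<longleftrightarrow>
     (\<forall>F :: ('x \<Rightarrow>\<^sub>L real) \<Rightarrow>\<^sub>L real. \<exists>x :: 'x. \<forall>f :: 'x \<Rightarrow>\<^sub>L real.
        blinfun_apply F f = blinfun_apply f x)"

definition strictly_convex_space :: "'x::real_normed_vector itself \<Rightarrow> bool" where
  "strictly_convex_space _ \<longleftrightarrow>
     (\<forall>x y :: 'x. norm x = 1 \<and> norm y = 1 \<and> x \<noteq> y \<longrightarrow> norm (x + y) < 2)"

text \<open>
  The normalised duality mapping is set-valued; it is never empty, and \<open>duality_map x\<close> is a singleton
  when the space is smooth.  For a space that is not known to be smooth, an identity such as
  $\langle y, J(x)\rangle = 0$ for all $y$ in a given set is read as: some single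
  \<open>f \<in> duality_map x\<close> vanishes on the whole set.  (In a strictly convex but non-smooth space, other
  members of \<open>duality_map x\<close> need not vanish there, even if \<open>x\<close> is the error of a best approximation
  from that set.)  In a smooth space this \<open>f\<close> is the value of the duality mapping at \<open>x\<close>.
\<close>

definition duality_map :: "'x::real_normed_vector \<Rightarrow> ('x \<Rightarrow>\<^sub>L real) set" where
  "duality_map x = {f. blinfun_apply f x = (norm x)\<^sup>2 \<and> (norm x)\<^sup>2 = (norm f)\<^sup>2}"

definition generates_flow :: "'x::real_normed_vector set \<Rightarrow> ('x \<Rightarrow> 'x) \<Rightarrow> bool" where
  "generates_flow DA A \<longleftrightarrow>
     (\<exists>\<Phi> :: real \<Rightarrow> 'x \<Rightarrow> 'x.
        (\<forall>t. bij_betw (\<Phi> t) DA DA) \<and>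
        (\<forall>u\<in>DA. \<Phi> 0 u = u) \<and>
        (\<forall>s t. \<forall>u\<in>DA. \<Phi> (t + s) u = \<Phi> t (\<Phi> s u)) \<and>
        (\<forall>u\<in>DA. \<forall>t. ((\<lambda>\<tau>. \<Phi> \<tau> u) has_vector_derivative A (\<Phi> t u)) (at t)))"

text \<open>
  The summand $W_\alpha \otimes_a \mathrm{span}\{\bigotimes_{\beta\neq\alpha} v_\beta\}$ consists of the
  elements $w \otimes \bigotimes_{\beta\neq\alpha} v_\beta$, and these are the tensors
  \<open>tens (v(\<alpha> := w))\<close>.
\<close>

definition hartree_tangent ::
    "'i set \<Rightarrow> (('i \<Rightarrow> 'a) \<Rightarrow> 'x::real_vector) \<Rightarrow> ('i \<Rightarrow> 'a) \<Rightarrow> ('i \<Rightarrow> 'a set) \<Rightarrow> 'x set" where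
  "hartree_tangent D tens v W =
     {s + (\<Sum>\<alpha>\<in>D. y \<alpha>) | s y.
        s \<in> span {tens v} \<and> (\<forall>\<alpha>\<in>D. y \<alpha> \<in> span {tens (v(\<alpha> := w)) | w. w \<in> W \<alpha>})}"

text \<open>
  The metric projection onto \<open>Z\<close> as a relation: \<open>z\<close> is the unique point of \<open>Z\<close> nearest to \<open>x\<close>.
  (A total function would need an arbitrary value wherever no nearest point exists.)
\<close>

definition is_metric_projection :: "'x::real_normed_vector set \<Rightarrow> 'x \<Rightarrow> 'x \<Rightarrow> bool" where
  "is_metric_projection Z x z \<longleftrightarrow>
     is_arg_min (\<lambda>y. norm (y - x)) (\<lambda>y. y \<in> Z) z \<and>
     (\<forall>z'. is_arg_min (\<lambda>y. norm (y - x)) (\<lambda>y. y \<in> Z) z' \<longrightarrow> z' = z)"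

end

theory Submission
  imports Defs
begin

text \<open>
  By multilinearity and $V_\alpha = \mathrm{span}\{v_\alpha\} \oplus W_\alpha$, the tangent space $Z$
  contains every tensor $w \otimes \bigotimes_{\beta\neq\alpha} v_\beta$ with $w \in V_\alpha$.  The
  error $e$ of a best approximation from the subspace $Z$ has distance $\|e\|$ to $Z$, so Hahn-Banach
  for the seminorm $\|e\| \cdot \mathrm{dist}(\cdot, Z)$ gives a functional in $J(e)$ that
  vanishes on $Z$.
\<close>

section \<open>The Hahn-Banach theorem for sublinear functionals\<close>

definition sublinear :: "('x::real_vector \<Rightarrow> real) \<Rightarrow> bool" where
  "sublinear p \<longleftrightarrow>
     (\<forall>x y. p (x + y) \<le> p x + p y) \<and> (\<forall>c\<ge>0. \<forall>x. p (c *\<^sub>R x) = c * p x)"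

lemma sublinear_add: "sublinear p \<Longrightarrow> p (x + y) \<le> p x + p y"
  by (simp add: sublinear_def)

lemma sublinear_scale: "sublinear p \<Longrightarrow> 0 \<le> c \<Longrightarrow> p (c *\<^sub>R x) = c * p x"
  by (simp add: sublinear_def)

lemma sublinear_zero: "sublinear p \<Longrightarrow> p 0 = 0"
  using sublinear_scale[of p 0 0] by simp

lemma sublinear_minus: "sublinear p \<Longrightarrow> - p (- x) \<le> p x"
  using sublinear_add[of p x "- x"] sublinear_zero[of p] by simp

text \<open>For c > 0 one inequality suffices: the same bound for \<open>inverse c\<close> at the
  point \<open>c *\<^sub>R x\<close> gives the reverse one. The case c = 0 is supplied by
  \<open>p 0 = 0\<close>.\<close>

lemma sublinearI:
  assumes add: "\<And>x y. p (x + y) \<le> p x + p y" and zero: "p 0 = 0"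
    and scale: "\<And>c x. 0 < c \<Longrightarrow> p (c *\<^sub>R x) \<le> c * p x"
  shows "sublinear p"
  unfolding sublinear_def
proof (intro conjI allI impI add)
  fix c :: real and x
  assume "0 \<le> c"
  show "p (c *\<^sub>R x) = c * p x"
  proof (cases "c = 0")
    case True
    then show ?thesis by (simp add: zero)
  next
    case False
    then have c: "0 < c" using \<open>0 \<le> c\<close> by simp
    have "p (inverse c *\<^sub>R c *\<^sub>R x) \<le> inverse c * p (c *\<^sub>R x)"
      using c by (intro scale) simp
    then have "c * p x \<le> p (c *\<^sub>R x)"
      using c by (simp add: field_simps)
    then show ?thesis using scale[OF c, of x] by simp
  qed
qed

text \<open>
  For a minimal sublinear \<open>p\<close> this forces \<open>q = p\<close>, so minimal sublinear functionals are additive.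
  Applied to \<open>p\<close> before minimising, it forces any linear functional below \<open>q\<close> to agree with \<open>p\<close> at \<open>e\<close>.
\<close>

lemma sublinear_refine:
  fixes p :: "'x::real_vector \<Rightarrow> real"
  assumes p: "sublinear p"
  obtains q where "sublinear q" "q \<le> p" "\<And>x. q x \<le> p (x + e) - p e"
proof -
  define F where "F x t = p (x + t *\<^sub>R e) - t * p e" for x t
  define q where "q x = (INF t\<in>{0..}. F x t)" for x
  \<comment> \<open>The infimum is finite, because t * p e = p (t e) \<le> p (x + t e) + p (-
    x).\<close>
  have lower: "- p (- x) \<le> F x t" if "t \<in> {0..}" for x t
    using sublinear_add[OF p, of "x + t *\<^sub>R e" "- x"] sublinear_scale[OF p, of t e] that
    by (simp add: F_def)
  have bdd: "bdd_below (F x ` {0..})" for x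
    using lower by (intro bdd_belowI2) auto
  have q_le: "q x \<le> F x t" if "0 \<le> t" for x t
    unfolding q_def using that by (intro cINF_lower bdd) simp
  have le_q: "c \<le> q x" if "\<And>t. 0 \<le> t \<Longrightarrow> c \<le> F x t" for c x
    unfolding q_def using that by (intro cINF_greatest) auto
  have "sublinear q"
  proof (rule sublinearI)
    fix x y
    \<comment> \<open>Parameters s for x and t for y combine into s + t for x + y. The infima over t
      and over s are then taken one after the other.\<close>
    have *: "q (x + y) \<le> F x s + F y t" if "0 \<le> s" "0 \<le> t" for s t
    proof -
      have "q (x + y) \<le> F (x + y) (s + t)" using that by (intro q_le) simp
      also have "\<dots> \<le> F x s + F y t"
        using sublinear_add[OF p, of "x + s *\<^sub>R e" "y + t *\<^sub>R e"]
        by (simp add: F_def algebra_simps)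
      finally show ?thesis .
    qed
    have "q (x + y) - F x s \<le> q y" if "0 \<le> s" for s
      using *[OF that] by (intro le_q) (simp add: algebra_simps)
    then have "q (x + y) - q y \<le> q x"
      by (intro le_q) (simp add: algebra_simps)
    then show "q (x + y) \<le> q x + q y" by simp
  next
    have "q 0 \<le> 0" using q_le[of 0 0] by (simp add: F_def sublinear_zero[OF p])
    moreover have "0 \<le> q 0"
      using lower[of _ 0] by (intro le_q) (simp add: sublinear_zero[OF p])
    ultimately show "q 0 = 0" by simp
  next
    fix c :: real and x
    assume c: "0 < c"
    have "q (c *\<^sub>R x) / c \<le> q x"
    proof (rule le_q)
      fix t :: real assume "0 \<le> t"
      \<comment> \<open>Rescaling the parameter along with the point makes \<open>F\<close>
        positively homogeneous.\<close>
      have "q (c *\<^sub>R x) \<le> F (c *\<^sub>R x) (c * t)" using c \<open>0 \<le> t\<close> by (intro q_le) simp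
      also have "\<dots> = c * F x t"
        using sublinear_scale[OF p, of c "x + t *\<^sub>R e"] c by (simp add: F_def algebra_simps)
      finally show "q (c *\<^sub>R x) / c \<le> F x t" using c by (simp add: field_simps)
    qed
    then show "q (c *\<^sub>R x) \<le> c * q x" using c by (simp add: field_simps)
  qed
  moreover have "q \<le> p"
  proof (rule le_funI)
    show "q x \<le> p x" for x using q_le[of 0 x] by (simp add: F_def)
  qed
  moreover have "q x \<le> p (x + e) - p e" for x using q_le[of 1 x] by (simp add: F_def)
  ultimately show ?thesis by (rule that)
qed

text \<open>The pointwise infimum works. It is finite since q x \<ge> - q (- x) \<ge> - p (- x) for
  every member q. Subadditivity uses the chain condition: to bound the infimum at x + y by q x + r
  y, take the smaller of q and r and its own subadditivity.\<close>

lemma sublinear_chain_Inf: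
  fixes p :: "'x::real_vector \<Rightarrow> real"
  assumes C: "\<And>q. q \<in> C \<Longrightarrow> sublinear q \<and> q \<le> p" and "C \<noteq> {}"
    and chain: "\<And>q r. q \<in> C \<Longrightarrow> r \<in> C \<Longrightarrow> q \<le> r \<or> r \<le> q"
  obtains l where "sublinear l" "\<And>q. q \<in> C \<Longrightarrow> l \<le> q"
proof -
  define l where "l x = (INF q\<in>C. q x)" for x
  have lower: "- p (- x) \<le> q x" if "q \<in> C" for q x
    using sublinear_minus[of q x] C[OF that] le_funD[of q p "- x"] by linarith
  have l_le: "l x \<le> q x" if "q \<in> C" for q x
    unfolding l_def using that lower by (intro cINF_lower bdd_belowI2) auto
  have le_l: "c \<le> l x" if "\<And>q. q \<in> C \<Longrightarrow> c \<le> q x" for c x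
    unfolding l_def using that \<open>C \<noteq> {}\<close> by (intro cINF_greatest)
  have "sublinear l"
  proof (rule sublinearI)
    fix x y
    have *: "l (x + y) \<le> q x + r y" if q: "q \<in> C" and r: "r \<in> C" for q r
    proof -
      obtain s where s: "s \<in> C" "s \<le> q" "s \<le> r" using chain[OF q r] q r by blast
      have "l (x + y) \<le> s (x + y)" using s by (intro l_le)
      also have "\<dots> \<le> s x + s y" using C[OF s(1)] by (intro sublinear_add) simp
      also have "\<dots> \<le> q x + r y" using s by (intro add_mono) (auto simp: le_fun_def)
      finally show ?thesis .
    qed
    have "l (x + y) - q x \<le> l y" if "q \<in> C" for q
      using *[OF that] by (intro le_l) (simp add: algebra_simps)
    then have "l (x + y) - l y \<le> l x"
      by (intro le_l) (simp add: algebra_simps)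
    then show "l (x + y) \<le> l x + l y" by simp
  next
    have *: "q 0 = 0" if "q \<in> C" for q using C[OF that] sublinear_zero by blast
    obtain q where "q \<in> C" using \<open>C \<noteq> {}\<close> by blast
    then have "l 0 \<le> 0" using l_le[of q 0] *[of q] by simp
    moreover have "0 \<le> l 0" by (rule le_l) (simp add: *)
    ultimately show "l 0 = 0" by simp
  next
    fix c :: real and x
    assume c: "0 < c"
    have "l (c *\<^sub>R x) / c \<le> l x"
    proof (rule le_l)
      fix q assume "q \<in> C"
      then have "l (c *\<^sub>R x) \<le> c * q x"
        using l_le[of q "c *\<^sub>R x"] C[of q] sublinear_scale[of q c x] c by simp
      then show "l (c *\<^sub>R x) / c \<le> q x" using c by (simp add: field_simps)
    qed
    then show "l (c *\<^sub>R x) \<le> c * l x" using c by (simp add: field_simps)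
  qed
  moreover have "l \<le> q" if "q \<in> C" for q using l_le[OF that] by (intro le_funI)
  ultimately show ?thesis by (rule that)
qed

text \<open>Zorn's lemma for the reversed pointwise order, in which maximal elements are the minimal
  functionals. A nonempty chain is bounded by its infimum, the empty one by \<open>p\<close>
  itself.\<close>

lemma minimal_sublinear_below:
  fixes p :: "'x::real_vector \<Rightarrow> real"
  assumes p: "sublinear p"
  obtains l where "sublinear l" "l \<le> p" "\<And>q. sublinear q \<Longrightarrow> q \<le> l \<Longrightarrow> q = l"
proof -
  let ?S = "{q. sublinear q \<and> q \<le> p}"
  have "\<exists>m\<in>?S. \<forall>q\<in>?S. m \<ge> q \<longrightarrow> q = m"
  proof (rule predicate_Zorn)
    show "partial_order_on ?S (relation_of (\<ge>) ?S)"
      by (rule partial_order_on_relation_ofI) auto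
  next
    fix C assume "C \<in> Chains (relation_of (\<ge>) ?S)"
    then have sub: "C \<subseteq> ?S" and chain: "\<And>q r. q \<in> C \<Longrightarrow> r \<in> C \<Longrightarrow> q \<le> r \<or> r \<le> q"
      by (auto simp: Chains_def relation_of_def)
    show "\<exists>u\<in>?S. \<forall>q\<in>C. q \<ge> u"
    proof (cases "C = {}")
      case True
      then show ?thesis using p by auto
    next
      case False
      with sublinear_chain_Inf[of C p] sub chain
      obtain l where "sublinear l" "\<And>q. q \<in> C \<Longrightarrow> l \<le> q" by blast
      moreover obtain q where "q \<in> C" using False by blast
      ultimately have "l \<in> ?S" using sub order_trans[of l q p] by blast
      then show ?thesis using \<open>\<And>q. q \<in> C \<Longrightarrow> l \<le> q\<close> by blast
    qed
  qed
  then obtain l where l: "sublinear l" "l \<le> p" "\<forall>q\<in>?S. q \<le> l \<longrightarrow> q = l" by blast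
  show ?thesis
  proof (rule that[OF l(1,2)])
    fix q assume "sublinear q" "q \<le> l"
    then show "q = l" using l(3) order_trans[OF \<open>q \<le> l\<close> l(2)] by simp
  qed
qed

text \<open>A minimal sublinear functional below the refinement of \<open>p\<close> at
  \<open>e\<close> is linear. Starting from the refinement rather than from \<open>p\<close> is what
  secures equality at \<open>e\<close>.\<close>

theorem hahn_banach_sublinear:
  fixes p :: "'x::real_vector \<Rightarrow> real"
  assumes p: "sublinear p"
  obtains l where "linear l" "\<And>x. l x \<le> p x" "l e = p e"
proof -
  obtain q where q: "sublinear q" "q \<le> p" "\<And>x. q x \<le> p (x + e) - p e"
    using sublinear_refine[OF p, where e = e] by blast
  obtain l where l: "sublinear l" "l \<le> q" "\<And>r. sublinear r \<Longrightarrow> r \<le> l \<Longrightarrow> r = l"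
    using minimal_sublinear_below[OF q(1)] by blast
  have add: "l (x + y) = l x + l y" for x y
  proof -
    \<comment> \<open>Minimality makes the refinement of \<open>l\<close> at \<open>y\<close> equal
      to \<open>l\<close>, which gives superadditivity; subadditivity is the other half.\<close>
    obtain r where r: "sublinear r" "r \<le> l" "\<And>x. r x \<le> l (x + y) - l y"
      using sublinear_refine[OF l(1), where e = y] by blast
    then have "r = l" using l(3) by blast
    then have "l x \<le> l (x + y) - l y" using r(3) by simp
    with sublinear_add[OF l(1), of x y] show ?thesis by simp
  qed
  have neg: "l (- x) = - l x" for x
    using add[of x "- x"] sublinear_zero[OF l(1)] by simp
  have "linear l"
  proof (rule linearI)
    fix c x
    show "l (c *\<^sub>R x) = c *\<^sub>R l x"
    proof (cases "0 \<le> c")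
      case True
      then show ?thesis by (simp add: sublinear_scale[OF l(1)])
    next
      case False
      then show ?thesis using sublinear_scale[OF l(1), of "- c" x] neg[of "c *\<^sub>R x"] by simp
    qed
  qed (rule add)
  moreover have le: "l x \<le> p x" for x 
    using order_trans[OF l(2) q(2)] by (simp add: le_fun_def)
  moreover have "l e = p e"
  proof -
    \<comment> \<open>At - e the refinement is at most p 0 - p e = - p e. Since \<open>l\<close> is
      odd, this upper bound becomes the lower bound for \<open>l e\<close>.\<close>
    have "l (- e) \<le> q (- e)" using l(2) by (simp add: le_fun_def)
    also have "\<dots> \<le> p 0 - p e" using q(3)[of "- e"] by simp
    finally have "p e \<le> l e" by (simp add: neg sublinear_zero[OF p])
    then show ?thesis using le[of e] by simp
  qed
  ultimately show ?thesis by (rule that)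
qed

section \<open>Best approximation from a subspace\<close>

text \<open>Almost nearest points can be added and scaled inside \<open>Z\<close>, and the resulting
  points bound the distances of x + y and of c x.\<close>

lemma sublinear_infdist_subspace:
  fixes Z :: "'x::real_normed_vector set"
  assumes Z: "subspace Z"
  shows "sublinear (\<lambda>x. infdist x Z)"
proof (rule sublinearI)
  have ne: "Z \<noteq> {}" using subspace_0[OF Z] by auto
  \<comment> \<open>The distance need not be attained, hence the slack \<epsilon>, removed at the
    end by \<open>field_le_epsilon\<close>.\<close>
  have approx: "\<exists>z\<in>Z. norm (x - z) < infdist x Z + \<epsilon>" if "0 < \<epsilon>" for x and \<epsilon> :: real
  proof (rule ccontr)
    assume "\<not> ?thesis"
    then have "infdist x Z + \<epsilon> \<le> infdist x Z"
      unfolding infdist_notempty[OF ne] using ne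
      by (intro cINF_greatest) (auto simp: infdist_notempty[OF ne] dist_norm not_less)
    then show False using that by simp
  qed
  show "infdist (x + y) Z \<le> infdist x Z + infdist y Z" for x y
  proof (rule field_le_epsilon)
    fix \<epsilon> :: real assume "0 < \<epsilon>"
    then obtain a b where ab: "a \<in> Z" "norm (x - a) < infdist x Z + \<epsilon> / 2"
      "b \<in> Z" "norm (y - b) < infdist y Z + \<epsilon> / 2"
      using approx[of "\<epsilon> / 2"] by (meson half_gt_zero)
    have "infdist (x + y) Z \<le> norm ((x - a) + (y - b))"
      using infdist_le[OF subspace_add[OF Z ab(1,3)], of "x + y"]
      by (simp add: dist_norm algebra_simps)
    also have "\<dots> \<le> norm (x - a) + norm (y - b)" by (rule norm_triangle_ineq)
    finally show "infdist (x + y) Z \<le> infdist x Z + infdist y Z + \<epsilon>" using ab by simp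
  qed
  show "infdist 0 Z = 0" using subspace_0[OF Z] by simp
  show "infdist (c *\<^sub>R x) Z \<le> c * infdist x Z" if c: "0 < c" for c x
  proof (rule field_le_epsilon)
    fix \<epsilon> :: real assume "0 < \<epsilon>"
    then obtain a where a: "a \<in> Z" "norm (x - a) < infdist x Z + \<epsilon> / c"
      using approx[of "\<epsilon> / c"] c by auto
    have "infdist (c *\<^sub>R x) Z \<le> norm (c *\<^sub>R (x - a))"
      using infdist_le[OF subspace_scale[OF Z a(1)], of "c *\<^sub>R x" c]
      by (simp add: dist_norm algebra_simps)
    also have "\<dots> \<le> c * infdist x Z + \<epsilon>"
      using mult_strict_left_mono[OF a(2) c] c by (simp add: distrib_left)
    finally show "infdist (c *\<^sub>R x) Z \<le> c * infdist x Z + \<epsilon>" .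
  qed
qed

text \<open>The assumption makes 0 a nearest point of \<open>Z\<close> to \<open>e\<close>, so the
  distance of \<open>e\<close> to \<open>Z\<close> is its norm. A linear functional below
  \<open>norm e * infdist x Z\<close> with equality at \<open>e\<close> has the value
  \<open>(norm e)\<^sup>2\<close> there, is bounded by \<open>norm e\<close> times the norm, and
  vanishes on \<open>Z\<close> because both z and - z have distance 0.\<close>

lemma duality_map_vanishing_on_subspace:
  fixes Z :: "'x::real_normed_vector set"
  assumes Z: "subspace Z" and near: "\<And>z. z \<in> Z \<Longrightarrow> norm e \<le> norm (e - z)"
  obtains f where "f \<in> duality_map e" "\<And>z. z \<in> Z \<Longrightarrow> blinfun_apply f z = 0"
proof -
  have zero: "0 \<in> Z" using subspace_0[OF Z] .
  have infdist_norm: "infdist x Z \<le> norm x" for x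
    using infdist_le[OF zero, of x] by simp
  have infdist_e: "infdist e Z = norm e"
  proof (rule antisym)
    show "norm e \<le> infdist e Z"
      unfolding infdist_def using zero near by (auto intro!: cINF_greatest simp: dist_norm)
  qed (rule infdist_norm)
  \<comment> \<open>The factor \<open>norm e\<close> provides the normalisation of the duality
    mapping, namely dual norm equal to \<open>norm e\<close>.\<close>
  have "sublinear (\<lambda>x. norm e * infdist x Z)"
    using sublinear_infdist_subspace[OF Z]
    by (auto simp: sublinear_def simp flip: distrib_left intro: mult_left_mono)
  then obtain l where l: "linear l" "\<And>x. l x \<le> norm e * infdist x Z"
    "l e = norm e * infdist e Z"
    using hahn_banach_sublinear[where e = e] by blast
  have upper: "l x \<le> norm e * norm x" for x
    using l(2)[of x] mult_left_mono[OF infdist_norm[of x], of "norm e"] by simp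
  have bound: "\<bar>l x\<bar> \<le> norm e * norm x" for x
    using upper[of x] upper[of "- x"] by (simp add: linear_neg[OF l(1)])
  have "bounded_linear l"
  proof (rule bounded_linear_intro[where K = "norm e"])
    show "norm (l x) \<le> norm x * norm e" for x using bound[of x] by (simp add: mult.commute)
  qed (simp_all add: linear_add[OF l(1)] linear_scale[OF l(1)])
  then obtain f where f: "blinfun_apply f = l" by (metis bounded_linear_Blinfun_apply)
  have fe: "blinfun_apply f e = (norm e)\<^sup>2"
    by (simp add: f l(3) infdist_e power2_eq_square)
  have "norm f \<le> norm e" by (rule norm_blinfun_bound) (simp_all add: f bound)
  moreover have "norm e \<le> norm f"
  proof (cases "e = 0")
    case False
    have "norm e * norm e \<le> norm f * norm e"
      using norm_blinfun[of f e] by (simp add: fe power2_eq_square)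
    then show ?thesis using False by simp
  qed simp
  ultimately have "f \<in> duality_map e" by (simp add: duality_map_def fe)
  moreover have "blinfun_apply f z = 0" if "z \<in> Z" for z
    using l(2)[of z] l(2)[of "- z"] that subspace_neg[OF Z that]
    by (simp add: f linear_neg[OF l(1)])
  ultimately show ?thesis by (rule that)
qed

text \<open>Subtracting a \<open>y\<close> in \<open>Z\<close> from \<open>z\<close> gives another
  competitor for the minimum, so 0 is a nearest point of \<open>Z\<close> to the error
  \<open>z - x\<close>.\<close>

lemma metric_projection_duality:
  fixes Z :: "'x::real_normed_vector set"
  assumes Z: "subspace Z" and proj: "is_metric_projection Z x z"
  obtains f where "f \<in> duality_map (z - x)" "\<And>y. y \<in> Z \<Longrightarrow> blinfun_apply f y = 0"
proof (rule duality_map_vanishing_on_subspace[OF Z])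
  have z: "z \<in> Z" "\<And>y. y \<in> Z \<Longrightarrow> norm (z - x) \<le> norm (y - x)"
    using proj by (auto simp: is_metric_projection_def is_arg_min_def not_less)
  show "norm (z - x) \<le> norm (z - x - y)" if "y \<in> Z" for y
    using z(2)[OF subspace_diff[OF Z z(1) that]] by (simp add: algebra_simps)
qed (rule that)

section \<open>Multilinearity and the tangent space\<close>

lemma free_lift_superset:
  assumes "finite S" "{v. c v \<noteq> 0} \<subseteq> S"
  shows "free_lift f c = (\<Sum>v\<in>S. c v *\<^sub>R f v)"
  unfolding free_lift_def using assms by (intro sum.mono_neutral_left) auto

lemma sum_generator:
  fixes f :: "('i \<Rightarrow> 'a) \<Rightarrow> 'b::real_vector"
  assumes "finite S" "v \<in> S"
  shows "(\<Sum>u\<in>S. generator v u *\<^sub>R f u) = f v"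
proof -
  have "(\<Sum>u\<in>S. generator v u *\<^sub>R f u) = (\<Sum>u\<in>S. if u = v then f u else 0)"
    by (intro sum.cong) (auto simp: generator_def)
  then show ?thesis using assms by simp
qed

text \<open>The additivity relation lies in the kernel of \<open>free_lift tens\<close>, and its
  image there is the difference of the two sides.\<close>

lemma tensor_product_add:
  assumes "is_algebraic_tensor_product D V tens"
    and "v \<in> PiE D V" "\<alpha> \<in> D" "x \<in> V \<alpha>" "y \<in> V \<alpha>"
  shows "tens (v(\<alpha> := x + y)) = tens (v(\<alpha> := x)) + tens (v(\<alpha> := y))"
proof -
  let ?S = "{v(\<alpha> := x + y), v(\<alpha> := x), v(\<alpha> := y)}"
  let ?c = "\<lambda>u. generator (v(\<alpha> := x + y)) u - generator (v(\<alpha> := x)) u - generator (v(\<alpha> := y)) u"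
  have "?c \<in> multilinear_relations D V" using assms(2-) by (rule multilinear_relations.additive)
  then have "free_lift tens ?c = 0" using assms(1) by (auto simp: is_algebraic_tensor_product_def)
  moreover have "free_lift tens ?c = (\<Sum>u\<in>?S. ?c u *\<^sub>R tens u)"
    by (rule free_lift_superset) (auto simp: generator_def)
  \<comment> \<open>The three tuples may coincide, for instance when y = 0. Splitting the sum by
    linearity and evaluating each generator separately avoids a case distinction.\<close>
  moreover have "\<dots> = tens (v(\<alpha> := x + y)) - tens (v(\<alpha> := x)) - tens (v(\<alpha> := y))"
    by (simp only: scaleR_left_diff_distrib sum_subtractf sum_generator finite.intros insertI1 insertI2)
  ultimately show ?thesis by (simp add: algebra_simps)
qed

lemma tensor_product_scale:
  assumes "is_algebraic_tensor_product D V tens"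
    and "v \<in> PiE D V" "\<alpha> \<in> D" "x \<in> V \<alpha>"
  shows "tens (v(\<alpha> := a *\<^sub>R x)) = a *\<^sub>R tens (v(\<alpha> := x))"
proof -
  let ?S = "{v(\<alpha> := a *\<^sub>R x), v(\<alpha> := x)}"
  let ?c = "\<lambda>u. generator (v(\<alpha> := a *\<^sub>R x)) u - a * generator (v(\<alpha> := x)) u"
  have "?c \<in> multilinear_relations D V"
    using assms(2-) by (rule multilinear_relations.homogeneous)
  then have "free_lift tens ?c = 0" using assms(1) by (auto simp: is_algebraic_tensor_product_def)
  moreover have "free_lift tens ?c = (\<Sum>u\<in>?S. ?c u *\<^sub>R tens u)"
    by (rule free_lift_superset) (auto simp: generator_def)
  moreover have "\<dots> = tens (v(\<alpha> := a *\<^sub>R x)) - a *\<^sub>R tens (v(\<alpha> := x))"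
    by (simp only: scaleR_left_diff_distrib sum_subtractf scaleR_scaleR[symmetric]
        scaleR_sum_right[symmetric] sum_generator finite.intros insertI1 insertI2)
  ultimately show ?thesis by simp
qed

lemma subspace_hartree_tangent: "subspace (hartree_tangent D tens v W)"
proof (rule subspaceI)
  let ?Z = "hartree_tangent D tens v W"
  let ?Y = "\<lambda>\<alpha>. span {tens (v(\<alpha> := w)) | w. w \<in> W \<alpha>}"
  show "0 \<in> ?Z"
    unfolding hartree_tangent_def
    by (rule CollectI, rule exI[of _ 0], rule exI[of _ "\<lambda>_. 0"]) (simp add: span_0)
  show "x + y \<in> ?Z" if "x \<in> ?Z" "y \<in> ?Z" for x y
  proof -
    obtain s a t b where "x = s + sum a D" "s \<in> span {tens v}" "\<forall>\<alpha>\<in>D. a \<alpha> \<in> ?Y \<alpha>"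
      "y = t + sum b D" "t \<in> span {tens v}" "\<forall>\<alpha>\<in>D. b \<alpha> \<in> ?Y \<alpha>"
      using \<open>x \<in> ?Z\<close> \<open>y \<in> ?Z\<close> unfolding hartree_tangent_def by blast
    then show ?thesis
      unfolding hartree_tangent_def
      by (intro CollectI exI[of _ "s + t"] exI[of _ "\<lambda>\<alpha>. a \<alpha> + b \<alpha>"])
        (simp add: span_add sum.distrib)
  qed
  show "c *\<^sub>R x \<in> ?Z" if "x \<in> ?Z" for c x
  proof -
    obtain s a where "x = s + sum a D" "s \<in> span {tens v}" "\<forall>\<alpha>\<in>D. a \<alpha> \<in> ?Y \<alpha>"
      using \<open>x \<in> ?Z\<close> unfolding hartree_tangent_def by blast
    then show ?thesis
      unfolding hartree_tangent_def
      by (intro CollectI exI[of _ "c *\<^sub>R s"] exI[of _ "\<lambda>\<alpha>. c *\<^sub>R a \<alpha>"])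
        (simp add: span_scale scaleR_add_right scaleR_sum_right)
  qed
qed

text \<open>Writing w as a multiple of \<open>v \<alpha>\<close> plus an element of
  \<open>W \<alpha>\<close> splits the tensor into a multiple of \<open>tens v\<close> and an
  element of the summand of index \<alpha>.\<close>

lemma tens_update_in_hartree_tangent:
  assumes tensor: "is_algebraic_tensor_product D V tens" and "finite D"
    and v: "v \<in> PiE D V" and \<alpha>: "\<alpha> \<in> D"
    and W: "closed_complement (V \<alpha>) n (span {v \<alpha>}) (W \<alpha>)"
    and sub: "subspace (V \<alpha>)" and w: "w \<in> V \<alpha>"
  shows "tens (v(\<alpha> := w)) \<in> hartree_tangent D tens v W"
proof -
  obtain c w' where w': "w = c *\<^sub>R v \<alpha> + w'" "w' \<in> W \<alpha>"
    using W w by (auto simp: closed_complement_def span_singleton)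
  have w'V: "w' \<in> V \<alpha>"
    using W w'(2) unfolding closed_complement_def closed_in_norm_def by blast
  have v\<alpha>: "v \<alpha> \<in> V \<alpha>" using v \<alpha> by (rule PiE_mem)
  have "tens (v(\<alpha> := w)) = tens (v(\<alpha> := c *\<^sub>R v \<alpha>)) + tens (v(\<alpha> := w'))"
    using tensor_product_add[of D V tens v \<alpha>, OF tensor v \<alpha> subspace_scale[OF sub v\<alpha>] w'V]
    by (simp only: w'(1))
  \<comment> \<open>Updating \<open>v\<close> at \<alpha> by its own value changes nothing.\<close>
  also have "tens (v(\<alpha> := c *\<^sub>R v \<alpha>)) = c *\<^sub>R tens v"
    using tensor_product_scale[of D V tens v \<alpha> "v \<alpha>" c, OF tensor v \<alpha> v\<alpha>] by simp
  finally have eq: "tens (v(\<alpha> := w)) = c *\<^sub>R tens v + tens (v(\<alpha> := w'))" .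
  \<comment> \<open>The family of summands is concentrated at \<alpha>; all other components are
    0.\<close>
  define y where "y \<beta> = (if \<beta> = \<alpha> then tens (v(\<alpha> := w')) else 0)" for \<beta>
  have "sum y D = tens (v(\<alpha> := w'))" using \<open>finite D\<close> \<alpha> by (simp add: y_def)
  then have "tens (v(\<alpha> := w)) = c *\<^sub>R tens v + sum y D" using eq by simp
  moreover have "c *\<^sub>R tens v \<in> span {tens v}" by (simp add: span_scale span_base)
  moreover have "\<forall>\<beta>\<in>D. y \<beta> \<in> span {tens (v(\<beta> := u)) | u. u \<in> W \<beta>}"
    using w'(2) by (auto simp: y_def span_0 intro: span_base)
  ultimately show ?thesis unfolding hartree_tangent_def by blast
qed

section \<open>Orthogonality of the projection error to single-factor variations\<close>

theorem theorem5p6: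
  fixes d :: nat and D :: "nat set"
    and V :: "nat \<Rightarrow> 'a::real_vector set"
    and nV :: "nat \<Rightarrow> 'a \<Rightarrow> real"
    and tens :: "(nat \<Rightarrow> 'a) \<Rightarrow> 'x::banach"
    and A :: "'x \<Rightarrow> 'x" and DA :: "'x set"
    and T :: real
    and v0 :: "nat \<Rightarrow> 'a"
    and v :: "real \<Rightarrow> nat \<Rightarrow> 'a"
    and W :: "real \<Rightarrow> nat \<Rightarrow> 'a set"
    and vr vr' :: "real \<Rightarrow> 'x"
  assumes D: "D = {1..d}" "d \<ge> 2"
    and banach: "\<And>\<alpha>. \<alpha> \<in> D \<Longrightarrow> banach_on (V \<alpha>) (nV \<alpha>)"
    and completion: "is_tensor_completion D V tens"
    and injective: "\<exists>C. \<forall>x \<in> algebraic_tensors D V tens. injective_norm D V nV tens x \<le> C * norm x"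
    and reflexive: "reflexive_space TYPE('x)"
    and strictly_convex: "strictly_convex_space TYPE('x)"
    and A: "linear_on DA A" "closure DA = UNIV" "generates_flow DA A"
    and T: "T > 0"
    and v0: "v0 \<in> PiE D V" "tens v0 \<in> hartree_manifold D V tens"
    and vr: "\<And>t. t \<in> {0..<T} \<Longrightarrow> v t \<in> PiE D V"
      "\<And>t. t \<in> {0..<T} \<Longrightarrow> vr t = tens (v t)"
      "\<And>t. t \<in> {0..<T} \<Longrightarrow> vr t \<in> hartree_manifold D V tens"
    and W: "\<And>t \<alpha>. t \<in> {0<..<T} \<Longrightarrow> \<alpha> \<in> D \<Longrightarrow>
      closed_complement (V \<alpha>) (nV \<alpha>) (span {v t \<alpha>}) (W t \<alpha>)"
    and in_domain: "\<And>t. t \<in> {0<..<T} \<Longrightarrow> vr t \<in> DA"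
    and derivative: "\<And>t. t \<in> {0<..<T} \<Longrightarrow> (vr has_vector_derivative vr' t) (at t)"
    and equation: "\<And>t. t \<in> {0<..<T} \<Longrightarrow>
      is_metric_projection (hartree_tangent D tens (v t) (W t)) (A (vr t)) (vr' t)"
    and initial: "vr 0 = tens v0" "continuous_on {0..<T} vr"
  shows "\<forall>t \<in> {0<..<T}. \<exists>f \<in> duality_map (vr' t - A (vr t)).
    \<forall>\<alpha>\<in>D. \<forall>w \<in> V \<alpha>. blinfun_apply f (tens ((v t)(\<alpha> := w))) = 0"
proof
  fix t assume t: "t \<in> {0<..<T}"
  let ?Z = "hartree_tangent D tens (v t) (W t)"
  have v: "v t \<in> PiE D V" using t by (intro vr(1)) simp
  have tensor: "is_algebraic_tensor_product D V tens"
    using completion by (simp add: is_tensor_completion_def)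
  \<comment> \<open>This \<open>f\<close> vanishes on the whole tangent space, so for the given t it
    serves all \<alpha> and w at once.\<close>
  obtain f where f: "f \<in> duality_map (vr' t - A (vr t))" "\<And>y. y \<in> ?Z \<Longrightarrow> blinfun_apply f y = 0"
    using metric_projection_duality[OF subspace_hartree_tangent equation[OF t]] by blast
  have "tens ((v t)(\<alpha> := w)) \<in> ?Z" if "\<alpha> \<in> D" "w \<in> V \<alpha>" for \<alpha> w
    using tensor _ v that(1) W[OF t that(1)] _ that(2)
  proof (rule tens_update_in_hartree_tangent)
    show "finite D" using D by simp
    show "subspace (V \<alpha>)" using banach[OF that(1)] by (simp add: banach_on_def)
  qed
  then show "\<exists>f \<in> duality_map (vr' t - A (vr t)).
      \<forall>\<alpha>\<in>D. \<forall>w \<in> V \<alpha>. blinfun_apply f (tens ((v t)(\<alpha> := w))) = 0"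
    using f by blast
qed

end
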